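(* The implicit difference scheme (written out in the context) of the two-dimensional time-space Caputo-Riesz fractional diffusion equation ${}_0^C D_t^{\gamma}u=c(x,y,t)\frac{\partial^{\alpha}u}{\partial|x|^{\alpha}}+d(x,y,t)\frac{\partial^{\beta}u}{\partial|y|^{\beta}}+f(x,y,t)$, $c,d\ge0$, with $0<\gamma\le1$, $1<\alpha,\beta\le2$, is unconditionally stable.
   Context: The equation is posed for $(x,y)\in\Omega=(x_L,x_R)\times(y_L,y_R)$, $0<t\le T$, with $u(x,y,0)=u_0(x,y)$ in $\Omega$ and $u=B$ on $\partial\Omega\times[0,T]$. "Stable" is meant in the usual sense for difference schemes (bounded propagation of the perturbation $\widetilde u_{i,j}^k-u_{i,j}^k$ between an approximate solution $\widetilde u_{i,j}^k$ and the exact solution $u_{i,j}^k$ of the scheme); "unconditionally" means without any restriction on the step sizes $\tau,\Delta x,\Delta y$. Derivatives: ${}_0^C D_t^\gamma u=\frac1{\Gamma(1-\gamma)}\int_0^t\partial_\eta u(x,y,\eta)(t-\eta)^{-\gamma}d\eta$ for $0<\gamma<1$ and $\partial_t u$ for $\gamma=1$ (Caputo). Riesz derivative: $\frac{\partial^\nu u}{\partial|x|^\nu}=-\kappa_\nu({}_{x_L}D_x^\nu+{}_xD_{x_R}^\nu)u$, $\kappa_\nu=\frac1{2\cos(\nu\pi/2)}$, with ${}_{x_L}D_x^\nu u=\frac1{\Gamma(2-\nu)}\partial_x^2\int_{x_L}^x(x-\xi)^{1-\nu}u(\xi,y,t)d\xi$ and ${}_xD_{x_R}^\nu u=\frac1{\Gamma(2-\nu)}\partial_x^2\int_x^{x_R}(\xi-x)^{1-\nu}u(\xi,y,t)d\xi$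 for $1<\nu<2$, both equal to $\partial_x^2u$ for $\nu=2$; analogously in $y$. Mesh: $x_i=x_L+i\Delta x$ $(i=0,\dots,N_x)$, $\Delta x=(x_R-x_L)/N_x$; $y_j=y_L+j\Delta y$ $(j=0,\dots,N_y)$, $\Delta y=(y_R-y_L)/N_y$; $t_k=k\tau$ $(k=0,\dots,N_t)$, $\tau=T/N_t$. Time coefficients: $l_s=(s+1)^{1-\gamma}-s^{1-\gamma}$ for $0<\gamma<1$; for $\gamma=1$, $l_0=1$ and $l_s=0$ for $s>0$. Space coefficients: $g_{i,m}^{\nu}=p_{i,m}^{\nu}+q_{i,m}^{\nu}$, where $p_{i,m}^{\nu}=a_{i-1,m}-2a_{i,m}+a_{i+1,m}$ for $m\le i-1$, $p_{i,i}^{\nu}=-2a_{i,i}+a_{i+1,i}$, $p_{i,i+1}^{\nu}=a_{i+1,i+1}$, $p_{i,m}^{\nu}=0$ for $m>i+1$; $q_{i,m}^{\nu}=0$ for $m<i-1$, $q_{i,i-1}^{\nu}=b_{i-1,i-1}$, $q_{i,i}^{\nu}=-2b_{i,i}+b_{i-1,i}$, $q_{i,m}^{\nu}=b_{i-1,m}-2b_{i,m}+b_{i+1,m}$ for $i+1\le m\le N$; and, for $j=i-1,i,i+1$: $a_{j,m}=1$ for $m=j$; otherwise $a_{j,0}=(j-1)^{3-\nu}-j^{2-\nu}(j-3+\nu)$ and $a_{j,m}=(j-m+1)^{3-\nu}-2(j-m)^{3-\nu}+(j-m-1)^{3-\nu}$ for $1\le m\le j-1$; $b_{j,m}=1$ for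 $m=j$; otherwise $b_{j,m}=(m-j+1)^{3-\nu}-2(m-j)^{3-\nu}+(m-j-1)^{3-\nu}$ for $j+1\le m\le N-1$ and $b_{j,N}=(3-\nu-N+j)(N-j)^{2-\nu}+(N-j-1)^{3-\nu}$. The $g_{i,m}^\alpha$ are taken with $\nu=\alpha$, $N=N_x$, and the $g_{j,m}^\beta$ with $\nu=\beta$, $N=N_y$. Further, $c_{i,j}^k=c(x_i,y_j,t_k)$, $d_{i,j}^k=d(x_i,y_j,t_k)$, $f_{i,j}^k=f(x_i,y_j,t_k)$, $\mu=\Gamma(2-\gamma)\tau^\gamma$, $\omega'_{i,j,k+1}=-\frac{\Gamma(2-\gamma)\tau^\gamma\kappa_\alpha c_{i,j}^{k+1}}{\Gamma(4-\alpha)(\Delta x)^\alpha}$, $\omega''_{i,j,k+1}=-\frac{\Gamma(2-\gamma)\tau^\gamma\kappa_\beta d_{i,j}^{k+1}}{\Gamma(4-\beta)(\Delta y)^\beta}$. Implicit scheme ($i=0,\dots,N_x$; $j=0,\dots,N_y$; $k\ge0$): $$(1-\omega'_{i,j,k+1}g_{i,i}^\alpha-\omega''_{i,j,k+1}g_{j,j}^\beta)u_{i,j}^{k+1}-\omega'_{i,j,k+1}\sum_{m=0,m\ne i}^{N_x}g_{i,m}^\alpha u_{m,j}^{k+1}-\omega''_{i,j,k+1}\sum_{m=0,m\ne j}^{N_y}g_{j,m}^\beta u_{i,m}^{k+1}=F_{i,j}^{k+1},$$ where $F_{i,j}^{1}=u_{i,j}^0+\mu f_{i,j}^1$ and, for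 $k>0$, $F_{i,j}^{k+1}=\sum_{s=0}^{k-1}(l_s-l_{s+1})u_{i,j}^{k-s}+l_ku_{i,j}^0+\mu f_{i,j}^{k+1}$. *)

theory Defs
  imports "HOL-Analysis.Analysis"
begin

text \<open>
  Data of the initial-boundary value problem
  \<open>D_t^gam u = cx * d^alpha u / d|x|^alpha + dy * d^beta u / d|y|^beta + src\<close> on
  \<open>(xL, xR) \<times> (yL, yR) \<times> (0, Tend]\<close> with boundary values \<open>bdry\<close>.
  The functions take their arguments in the order \<open>x, y, t\<close>.
\<close>

record cr_problem =
  gam :: real
  alpha :: real
  beta :: real
  xL :: real
  xR :: real
  yL :: real
  yR :: real
  Tend :: real
  cx :: "real \<Rightarrow> real \<Rightarrow> real \<Rightarrow> real"
  dy :: "real \<Rightarrow> real \<Rightarrow> real \<Rightarrow> real"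
  src :: "real \<Rightarrow> real \<Rightarrow> real \<Rightarrow> real"
  bdry :: "real \<Rightarrow> real \<Rightarrow> real \<Rightarrow> real"

definition step_x :: "cr_problem \<Rightarrow> nat \<Rightarrow> real" where
  "step_x P Nx = (xR P - xL P) / real Nx"

definition step_y :: "cr_problem \<Rightarrow> nat \<Rightarrow> real" where
  "step_y P Ny = (yR P - yL P) / real Ny"

definition step_t :: "cr_problem \<Rightarrow> nat \<Rightarrow> real" where
  "step_t P Nt = Tend P / real Nt"

definition node_x :: "cr_problem \<Rightarrow> nat \<Rightarrow> nat \<Rightarrow> real" where
  "node_x P Nx i = xL P + real i * step_x P Nx"

definition node_y :: "cr_problem \<Rightarrow> nat \<Rightarrow> nat \<Rightarrow> real" where
  "node_y P Ny j = yL P + real j * step_y P Ny"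

definition node_t :: "cr_problem \<Rightarrow> nat \<Rightarrow> nat \<Rightarrow> real" where
  "node_t P Nt k = real k * step_t P Nt"

definition l_coeff :: "real \<Rightarrow> nat \<Rightarrow> real" where
  "l_coeff \<gamma> s =
    (if \<gamma> = 1 then (if s = 0 then 1 else 0)
     else real (s + 1) powr (1 - \<gamma>) - real s powr (1 - \<gamma>))"

text \<open>
  The indices are integers because \<open>g_coeff \<nu> N 0 m\<close> involves \<open>b_coeff \<nu> N (-1) m\<close>.
  The values of \<open>a_coeff \<nu> j m\<close> for \<open>m > j\<close> and of \<open>b_coeff \<nu> N j m\<close> for \<open>m < j\<close>
  are never used, and all bases of \<open>powr\<close> that do occur are nonnegative.
\<close>

definition a_coeff :: "real \<Rightarrow> int \<Rightarrow> int \<Rightarrow> real" where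
  "a_coeff \<nu> j m =
    (if m = j then 1
     else if m = 0 then
       of_int (j - 1) powr (3 - \<nu>) - of_int j powr (2 - \<nu>) * (of_int j - 3 + \<nu>)
     else
       of_int (j - m + 1) powr (3 - \<nu>) - 2 * of_int (j - m) powr (3 - \<nu>)
         + of_int (j - m - 1) powr (3 - \<nu>))"

definition b_coeff :: "real \<Rightarrow> nat \<Rightarrow> int \<Rightarrow> int \<Rightarrow> real" where
  "b_coeff \<nu> N j m =
    (if m = j then 1
     else if m = int N then
       (3 - \<nu> - real N + of_int j) * of_int (int N - j) powr (2 - \<nu>)
         + of_int (int N - j - 1) powr (3 - \<nu>)
     else
       of_int (m - j + 1) powr (3 - \<nu>) - 2 * of_int (m - j) powr (3 - \<nu>)
         + of_int (m - j - 1) powr (3 - \<nu>))"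

definition p_coeff :: "real \<Rightarrow> int \<Rightarrow> int \<Rightarrow> real" where
  "p_coeff \<nu> i m =
    (if m \<le> i - 1 then a_coeff \<nu> (i - 1) m - 2 * a_coeff \<nu> i m + a_coeff \<nu> (i + 1) m
     else if m = i then - 2 * a_coeff \<nu> i i + a_coeff \<nu> (i + 1) i
     else if m = i + 1 then a_coeff \<nu> (i + 1) (i + 1)
     else 0)"

definition q_coeff :: "real \<Rightarrow> nat \<Rightarrow> int \<Rightarrow> int \<Rightarrow> real" where
  "q_coeff \<nu> N i m =
    (if m < i - 1 then 0
     else if m = i - 1 then b_coeff \<nu> N (i - 1) (i - 1)
     else if m = i then - 2 * b_coeff \<nu> N i i + b_coeff \<nu> N (i - 1) i
     else b_coeff \<nu> N (i - 1) m - 2 * b_coeff \<nu> N i m + b_coeff \<nu> N (i + 1) m)"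

definition g_coeff :: "real \<Rightarrow> nat \<Rightarrow> nat \<Rightarrow> nat \<Rightarrow> real" where
  "g_coeff \<nu> N i m = p_coeff \<nu> (int i) (int m) + q_coeff \<nu> N (int i) (int m)"

definition riesz_kappa :: "real \<Rightarrow> real" where
  "riesz_kappa \<nu> = 1 / (2 * cos (\<nu> * pi / 2))"

definition mu_factor :: "cr_problem \<Rightarrow> nat \<Rightarrow> real" where
  "mu_factor P Nt = Gamma (2 - gam P) * step_t P Nt powr gam P"

text \<open>\<open>omega_x P Nx Ny Nt i j n\<close> is the coefficient at time level \<open>n\<close>; similarly \<open>omega_y\<close>.\<close>

definition omega_x :: "cr_problem \<Rightarrow> nat \<Rightarrow> nat \<Rightarrow> nat \<Rightarrow> nat \<Rightarrow> nat \<Rightarrow> nat \<Rightarrow> real" where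
  "omega_x P Nx Ny Nt i j n =
    - (Gamma (2 - gam P) * step_t P Nt powr gam P * riesz_kappa (alpha P)
        * cx P (node_x P Nx i) (node_y P Ny j) (node_t P Nt n))
      / (Gamma (4 - alpha P) * step_x P Nx powr alpha P)"

definition omega_y :: "cr_problem \<Rightarrow> nat \<Rightarrow> nat \<Rightarrow> nat \<Rightarrow> nat \<Rightarrow> nat \<Rightarrow> nat \<Rightarrow> real" where
  "omega_y P Nx Ny Nt i j n =
    - (Gamma (2 - gam P) * step_t P Nt powr gam P * riesz_kappa (beta P)
        * dy P (node_x P Nx i) (node_y P Ny j) (node_t P Nt n))
      / (Gamma (4 - beta P) * step_y P Ny powr beta P)"

text \<open>A grid function \<open>u\<close> takes its arguments in the order \<open>k, i, j\<close> (time level first).\<close>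

definition scheme_rhs ::
  "cr_problem \<Rightarrow> nat \<Rightarrow> nat \<Rightarrow> nat \<Rightarrow> (nat \<Rightarrow> nat \<Rightarrow> nat \<Rightarrow> real) \<Rightarrow> nat \<Rightarrow> nat \<Rightarrow> nat \<Rightarrow> real" where
  "scheme_rhs P Nx Ny Nt u k i j =
    (if k = 0 then u 0 i j
     else (\<Sum>s = 0..k - 1. (l_coeff (gam P) s - l_coeff (gam P) (s + 1)) * u (k - s) i j)
            + l_coeff (gam P) k * u 0 i j)
      + mu_factor P Nt * src P (node_x P Nx i) (node_y P Ny j) (node_t P Nt (k + 1))"

definition scheme_eq ::
  "cr_problem \<Rightarrow> nat \<Rightarrow> nat \<Rightarrow> nat \<Rightarrow> (nat \<Rightarrow> nat \<Rightarrow> nat \<Rightarrow> real) \<Rightarrow> nat \<Rightarrow> nat \<Rightarrow> nat \<Rightarrow> bool" where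
  "scheme_eq P Nx Ny Nt u k i j \<longleftrightarrow>
    (1 - omega_x P Nx Ny Nt i j (k + 1) * g_coeff (alpha P) Nx i i
       - omega_y P Nx Ny Nt i j (k + 1) * g_coeff (beta P) Ny j j) * u (k + 1) i j
    - omega_x P Nx Ny Nt i j (k + 1)
        * (\<Sum>m\<in>{0..Nx} - {i}. g_coeff (alpha P) Nx i m * u (k + 1) m j)
    - omega_y P Nx Ny Nt i j (k + 1)
        * (\<Sum>m\<in>{0..Ny} - {j}. g_coeff (beta P) Ny j m * u (k + 1) i m)
    = scheme_rhs P Nx Ny Nt u k i j"

definition all_nodes :: "nat \<Rightarrow> nat \<Rightarrow> (nat \<times> nat) set" where
  "all_nodes Nx Ny = {0..Nx} \<times> {0..Ny}"

definition interior_nodes :: "nat \<Rightarrow> nat \<Rightarrow> (nat \<times> nat) set" where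
  "interior_nodes Nx Ny = {0<..<Nx} \<times> {0<..<Ny}"

text \<open>
  \<open>S\<close> is the set of mesh nodes at which the initial value is prescribed and the difference
  equations are imposed; at the remaining mesh nodes the values are those of \<open>bdry\<close>.
  With \<open>S = all_nodes Nx Ny\<close> the difference equations hold for all \<open>i = 0..Nx\<close>, \<open>j = 0..Ny\<close> and no
  boundary value enters; with \<open>S = interior_nodes Nx Ny\<close> the boundary condition is imposed
  at the boundary nodes instead of the difference equations.
\<close>

definition scheme_solution ::
  "cr_problem \<Rightarrow> nat \<Rightarrow> nat \<Rightarrow> nat \<Rightarrow> (nat \<times> nat) set \<Rightarrow> (real \<Rightarrow> real \<Rightarrow> real)
    \<Rightarrow> (nat \<Rightarrow> nat \<Rightarrow> nat \<Rightarrow> real) \<Rightarrow> bool" where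
  "scheme_solution P Nx Ny Nt S u0 u \<longleftrightarrow>
    (\<forall>(i, j)\<in>S. u 0 i j = u0 (node_x P Nx i) (node_y P Ny j)) \<and>
    (\<forall>k<Nt. \<forall>(i, j)\<in>S. scheme_eq P Nx Ny Nt u k i j) \<and>
    (\<forall>k\<le>Nt. \<forall>(i, j)\<in>all_nodes Nx Ny - S.
       u k i j = bdry P (node_x P Nx i) (node_y P Ny j) (node_t P Nt k))"

definition grid_max_norm :: "nat \<Rightarrow> nat \<Rightarrow> (nat \<Rightarrow> nat \<Rightarrow> real) \<Rightarrow> real" where
  "grid_max_norm Nx Ny e = Max ((\<lambda>(i, j). \<bar>e i j\<bar>) ` all_nodes Nx Ny)"

text \<open>
  Stability: the perturbation between an approximate solution \<open>v\<close> (the same scheme started from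
  perturbed initial values) and the exact solution \<open>u\<close> of the scheme is bounded at all time levels
  by a constant times the initial perturbation.  Unconditional: one constant \<open>C\<close> serves all meshes.
\<close>

definition unconditionally_stable ::
  "cr_problem \<Rightarrow> (nat \<Rightarrow> nat \<Rightarrow> (nat \<times> nat) set) \<Rightarrow> bool" where
  "unconditionally_stable P nodes \<longleftrightarrow>
    (\<exists>C. \<forall>Nx Ny Nt u0 v0 u v.
      0 < Nx \<and> 0 < Ny \<and> 0 < Nt \<and>
      scheme_solution P Nx Ny Nt (nodes Nx Ny) u0 u \<and>
      scheme_solution P Nx Ny Nt (nodes Nx Ny) v0 v \<longrightarrow>
      (\<forall>k\<le>Nt. grid_max_norm Nx Ny (\<lambda>i j. v k i j - u k i j)
               \<le> C * grid_max_norm Nx Ny (\<lambda>i j. v 0 i j - u 0 i j)))"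

end

theory Submission
  imports Defs
begin

text \<open>
  The off-diagonal entries of the matrix \<open>(g_coeff \<nu> N i m)\<close> are nonnegative; away from the
  diagonal they are second or fourth differences of functions whose second or fourth derivative is
  nonnegative.  However, the matrix is not diagonally dominant: for \<open>1 < \<nu> < 2\<close> and large \<open>N\<close>
  its row \<open>1\<close> has a positive sum, because the quadrature weights \<open>a_coeff \<nu> j m\<close> add up to
  \<open>(3 - \<nu>) * j powr (2 - \<nu>)\<close> for \<open>j > 0\<close> but to \<open>1\<close>, not \<open>0\<close>, for \<open>j = 0\<close>.
  So the plain discrete maximum principle fails.  It is repaired by lowering the weight of the two end
  nodes from \<open>1\<close> to a number \<open>\<eta> > 0\<close> depending only on \<open>\<nu>\<close>, for which all weighted row sums become
  nonpositive.  The products of these weights in \<open>x\<close> and in \<open>y\<close> give a weighted maximum norm in which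
  every implicit step is a contraction; the memory term is a convex combination of earlier
  levels as \<open>l_coeff \<gamma>\<close> is decreasing.  Returning to the plain norm costs the factor
  \<open>1 / (\<eta>\<^sub>\<alpha> \<eta>\<^sub>\<beta>)\<close>.
\<close>

section \<open>Differences of powers\<close>

text \<open>The mean value theorem for \<open>f (t + 1) - f t\<close> turns the second difference
  into \<open>f' (z + 1) - f' z\<close>, and \<open>f'\<close> is nondecreasing. Derivatives are
  asked for only in the open interval, so that \<open>a\<close> may be a point such as 0 where a
  power is merely continuous.\<close>

lemma second_difference_nonneg:
  fixes f f' f'' :: "real \<Rightarrow> real"
  assumes cont: "continuous_on {a..a + 2} f"
    and D1: "\<And>x. a < x \<Longrightarrow> x < a + 2 \<Longrightarrow> (f has_real_derivative f' x) (at x)"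
    and D2: "\<And>x. a < x \<Longrightarrow> x < a + 2 \<Longrightarrow> (f' has_real_derivative f'' x) (at x)"
    and nonneg: "\<And>x. a < x \<Longrightarrow> x < a + 2 \<Longrightarrow> 0 \<le> f'' x"
  shows "0 \<le> f a - 2 * f (a + 1) + f (a + 2)"
proof -
  let ?g = "\<lambda>t. f (t + 1) - f t"
  have D: "(?g has_real_derivative f' (x + 1) - f' x) (at x)" if "a < x" "x < a + 1" for x
  proof -
    have "(f has_real_derivative f' (x + 1)) (at (x + 1))"
      using D1[of "x + 1"] that by simp
    then have "((\<lambda>t. f (t + 1)) has_real_derivative f' (x + 1)) (at x)"
      by (simp add: DERIV_shift)
    then show ?thesis
      using D1[of x] that by (intro DERIV_diff) auto
  qed
  have "continuous_on {a..a + 1} ?g"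
  proof (intro continuous_on_diff)
    show "continuous_on {a..a + 1} (\<lambda>t. f (t + 1))"
      by (rule continuous_on_compose2[OF cont]) (auto intro!: continuous_intros)
    show "continuous_on {a..a + 1} f"
      by (rule continuous_on_subset[OF cont]) auto
  qed
  then obtain l z where z: "a < z" "z < a + 1" and l: "(?g has_real_derivative l) (at z)"
    and eq: "?g (a + 1) - ?g a = (a + 1 - a) * l"
    using MVT[of a "a + 1" ?g] D unfolding real_differentiable_def by auto
  have "l = f' (z + 1) - f' z"
    using DERIV_unique[OF l D[OF z]] .
  moreover have "f' z \<le> f' (z + 1)"
  proof (rule DERIV_nonneg_imp_nondecreasing[where f = f'])
    fix x assume "z \<le> x" "x \<le> z + 1"
    with z have "a < x" "x < a + 2" by auto
    then show "\<exists>y. (f' has_real_derivative y) (at x) \<and> 0 \<le> y"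
      using D2 nonneg by blast
  qed simp
  ultimately show ?thesis
    using eq by (simp add: add.assoc)
qed

lemma second_difference_powr_nonneg:
  fixes x e :: real
  assumes "1 < x" "0 \<le> e * (e - 1)"
  shows "0 \<le> (x + 1) powr e - 2 * x powr e + (x - 1) powr e"
proof -
  have "0 \<le> (\<lambda>t. t powr e) (x - 1) - 2 * (\<lambda>t. t powr e) (x - 1 + 1) + (\<lambda>t. t powr e) (x - 1 + 2)"
  proof (rule second_difference_nonneg[where f' = "\<lambda>t. e * t powr (e - 1)"
        and f'' = "\<lambda>t. e * (e - 1) * t powr (e - 2)"])
    show "continuous_on {x - 1..x - 1 + 2} (\<lambda>t. t powr e)"
      using assms by (intro continuous_intros) auto
    show "0 \<le> e * (e - 1) * t powr (e - 2)" for t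
      using assms by (intro mult_nonneg_nonneg[OF assms(2)]) auto
  qed (use assms in \<open>auto intro!: derivative_eq_intros simp: algebra_simps\<close>)
  then show ?thesis by (simp add: algebra_simps)
qed

text \<open>Concavity of \<open>t powr c\<close>. The last hypothesis secures continuity at 0, which
  fails for \<open>c = 0\<close> since \<open>0 powr 0 = 0\<close>.\<close>

lemma second_difference_powr_nonpos:
  fixes x c :: real
  assumes "0 \<le> x" "0 \<le> c" "c \<le> 1" "0 < x \<or> 0 < c"
  shows "x powr c - 2 * (x + 1) powr c + (x + 2) powr c \<le> 0"
proof -
  have "0 \<le> (\<lambda>t. - (t powr c)) x - 2 * (\<lambda>t. - (t powr c)) (x + 1) + (\<lambda>t. - (t powr c)) (x + 2)"
  proof (rule second_difference_nonneg[where f' = "\<lambda>t. - (c * t powr (c - 1))"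
        and f'' = "\<lambda>t. c * (1 - c) * t powr (c - 2)"])
    show "continuous_on {x..x + 2} (\<lambda>t. - (t powr c))"
      using assms by (intro continuous_intros continuous_on_powr') auto
    show "0 \<le> c * (1 - c) * t powr (c - 2)" for t
      using assms by auto
  qed (use assms in \<open>auto intro!: derivative_eq_intros simp: algebra_simps\<close>)
  then show ?thesis by simp
qed

text \<open>A fourth difference is a second difference of the central second difference
  \<open>?f\<close>. The second derivative of \<open>?f\<close> is \<open>b * (b - 1)\<close> times
  the second difference of \<open>t powr (b - 2)\<close>, a convex function because
  \<open>b - 2 \<le> 0\<close>.\<close>

lemma fourth_difference_powr_nonneg:
  fixes x b :: real
  assumes "2 \<le> x" "1 \<le> b" "b \<le> 2"
  shows "0 \<le> (x + 2) powr b - 4 * (x + 1) powr b + 6 * x powr b - 4 * (x - 1) powr b + (x - 2) powr b"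
proof -
  let ?f = "\<lambda>t. (t + 1) powr b - 2 * t powr b + (t - 1) powr b"
  have "0 \<le> ?f (x - 1) - 2 * ?f (x - 1 + 1) + ?f (x - 1 + 2)"
  proof (rule second_difference_nonneg[where
        f' = "\<lambda>t. b * ((t + 1) powr (b - 1) - 2 * t powr (b - 1) + (t - 1) powr (b - 1))"
        and f'' = "\<lambda>t. b * (b - 1) * ((t + 1) powr (b - 2) - 2 * t powr (b - 2) + (t - 1) powr (b - 2))"])
    show "continuous_on {x - 1..x - 1 + 2} ?f"
      using assms by (intro continuous_intros continuous_on_powr') auto
    show "(?f has_real_derivative b * ((t + 1) powr (b - 1) - 2 * t powr (b - 1) + (t - 1) powr (b - 1))) (at t)"
      if "x - 1 < t" for t
      using that assms by (auto intro!: derivative_eq_intros simp: algebra_simps)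
    show "((\<lambda>t. b * ((t + 1) powr (b - 1) - 2 * t powr (b - 1) + (t - 1) powr (b - 1)))
       has_real_derivative b * (b - 1) * ((t + 1) powr (b - 2) - 2 * t powr (b - 2) + (t - 1) powr (b - 2))) (at t)"
      if "x - 1 < t" for t
      using that assms by (auto intro!: derivative_eq_intros simp: algebra_simps)
    show "0 \<le> b * (b - 1) * ((t + 1) powr (b - 2) - 2 * t powr (b - 2) + (t - 1) powr (b - 2))"
      if "x - 1 < t" for t
    proof -
      have "0 \<le> (b - 2) * (b - 2 - 1)"
        using assms by (intro mult_nonpos_nonpos) auto
      then show ?thesis
        using second_difference_powr_nonneg[of t "b - 2"] that assms by simp
    qed
  qed
  then show ?thesis by (simp add: algebra_simps)
qed

text \<open>The convex function \<open>t powr e\<close> lies above its tangent at \<open>x\<close>,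
  here evaluated at \<open>x - 1\<close>.\<close>

lemma powr_tangent:
  fixes x e :: real
  assumes "1 < x" "e \<le> 0"
  shows "0 \<le> (x - 1) powr e - x powr e + e * x powr (e - 1)"
proof -
  obtain z where z: "x - 1 < z" "z < x"
    and eq: "x powr e - (x - 1) powr e = (x - (x - 1)) * (e * z powr (e - 1))"
    using MVT2[of "x - 1" x "\<lambda>t. t powr e" "\<lambda>t. e * t powr (e - 1)"] assms
      has_real_derivative_powr by fastforce
  have "x powr (e - 1) \<le> z powr (e - 1)"
    using z assms by (intro powr_mono2') auto
  then show ?thesis
    using eq mult_left_mono_neg[of "x powr (e - 1)" "z powr (e - 1)" e] assms by simp
qed

text \<open>With \<open>b = 3 - \<nu>\<close>, \<open>f j\<close> is the end coefficient
  \<open>a_coeff \<nu> j 0\<close> for \<open>j > 0\<close>. Its second derivative is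
  \<open>b * (b - 1)\<close> times the tangent gap of \<open>t powr (b - 2)\<close>.\<close>

lemma second_difference_end_coeff_nonneg:
  fixes x b :: real
  assumes "2 \<le> x" "1 \<le> b" "b \<le> 2"
  defines "f \<equiv> \<lambda>t. (t - 1) powr b - t powr b + b * t powr (b - 1)"
  shows "0 \<le> f (x - 1) - 2 * f x + f (x + 1)"
proof -
  have "0 \<le> f (x - 1) - 2 * f (x - 1 + 1) + f (x - 1 + 2)"
  proof (rule second_difference_nonneg[where
        f' = "\<lambda>t. b * ((t - 1) powr (b - 1) - t powr (b - 1) + (b - 1) * t powr (b - 2))"
        and f'' = "\<lambda>t. b * (b - 1) * ((t - 1) powr (b - 2) - t powr (b - 2) + (b - 2) * t powr (b - 3))"])
    show "continuous_on {x - 1..x - 1 + 2} f"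
      unfolding f_def using assms by (intro continuous_intros continuous_on_powr') auto
    show "(f has_real_derivative b * ((t - 1) powr (b - 1) - t powr (b - 1) + (b - 1) * t powr (b - 2))) (at t)"
      if "x - 1 < t" for t
      unfolding f_def using that assms by (auto intro!: derivative_eq_intros simp: algebra_simps)
    show "((\<lambda>t. b * ((t - 1) powr (b - 1) - t powr (b - 1) + (b - 1) * t powr (b - 2)))
       has_real_derivative b * (b - 1) * ((t - 1) powr (b - 2) - t powr (b - 2) + (b - 2) * t powr (b - 3))) (at t)"
      if "x - 1 < t" for t
      using that assms by (auto intro!: derivative_eq_intros simp: algebra_simps)
    show "0 \<le> b * (b - 1) * ((t - 1) powr (b - 2) - t powr (b - 2) + (b - 2) * t powr (b - 3))"
      if "x - 1 < t" for t
      using powr_tangent[of t "b - 2"] that assms by simp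
  qed
  then show ?thesis by (simp add: algebra_simps)
qed

text \<open>The expression decreases on [1, 2] and vanishes at \<open>b = 2\<close>. It controls the
  entries next to the diagonal, where the fourth difference argument does not apply.\<close>

lemma near_diagonal_bound:
  fixes b :: real
  assumes "1 \<le> b" "b \<le> 2"
  shows "0 \<le> 7 - 4 * 2 powr b + 3 powr b"
proof -
  let ?h = "\<lambda>t. 7 - 4 * 2 powr t + 3 powr (t::real) :: real"
  \<comment> \<open>That is, 3^9 = 19683 is at most 2^16 = 65536. Together with
    \<open>3 powr t \<le> 9/4 * 2 powr t\<close> for \<open>t \<le> 2\<close> this gives the sign of
    the derivative.\<close>
  have ln23: "9 * ln 3 \<le> 16 * ln (2::real)"
  proof -
    have "9 * ln 3 = ln ((3::real) ^ 9)" by (subst ln_realpow) auto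
    also have "\<dots> \<le> ln (2 ^ 16)" by (subst ln_le_cancel_iff) auto
    also have "\<dots> = 16 * ln (2::real)" by (subst ln_realpow) auto
    finally show ?thesis .
  qed
  have "?h 2 \<le> ?h b"
  proof (rule DERIV_nonpos_imp_nonincreasing[OF assms(2)])
    fix t assume t: "b \<le> t" "t \<le> 2"
    have "(3/2) powr t \<le> (3/2::real) powr 2"
      using t by (intro powr_mono) auto
    moreover have "3 powr t = (3/2) powr t * 2 powr t"
      by (simp add: powr_divide)
    ultimately have "3 powr t \<le> 9/4 * 2 powr t"
      using mult_right_mono[of "(3/2) powr t" "9/4" "2 powr t"] by (simp add: power2_eq_square)
    then have "ln 3 * 3 powr t \<le> ln 3 * (9/4 * 2 powr t)"
      by (intro mult_left_mono) auto
    also have "\<dots> = (9 * ln 3) / 4 * 2 powr t" by simp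
    also have "\<dots> \<le> (16 * ln 2) / 4 * 2 powr t"
      using ln23 by (intro mult_right_mono divide_right_mono) auto
    finally have "- 4 * (2 powr t * ln 2) + 3 powr t * ln 3 \<le> 0"
      by (simp add: algebra_simps)
    moreover have "(?h has_real_derivative - 4 * (2 powr t * ln 2) + 3 powr t * ln 3) (at t)"
      by (auto intro!: derivative_eq_intros)
    ultimately show "\<exists>y. (?h has_real_derivative y) (at t) \<and> y \<le> 0" by blast
  qed
  then show ?thesis by simp
qed

section \<open>The spatial coefficients\<close>

lemma b_coeff_reflect: "b_coeff \<nu> N j m = a_coeff \<nu> (int N - j) (int N - m)"
  unfolding a_coeff_def b_coeff_def by (auto simp: algebra_simps)

lemma q_coeff_reflect: "q_coeff \<nu> N i m = p_coeff \<nu> (int N - i) (int N - m)"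
  unfolding p_coeff_def q_coeff_def b_coeff_reflect by (auto simp: algebra_simps)

text \<open>The right-sided part is the left-sided one under the reflection m -> N - m of the grid,
  so only \<open>p_coeff\<close> has to be studied.\<close>

lemma g_coeff_reflect:
  assumes "i \<le> N" "m \<le> N"
  shows "g_coeff \<nu> N i m = p_coeff \<nu> (int i) (int m) + p_coeff \<nu> (int (N - i)) (int (N - m))"
  using assms by (simp add: g_coeff_def q_coeff_reflect of_nat_diff)

lemma a_coeff_diag [simp]: "a_coeff \<nu> j j = 1"
  by (simp add: a_coeff_def)

lemma a_coeff_zero:
  assumes "0 < j"
  shows "a_coeff \<nu> (int j) 0
    = (real j - 1) powr (3 - \<nu>) - real j powr (3 - \<nu>) + (3 - \<nu>) * real j powr (2 - \<nu>)"
proof -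
  have "real j powr (3 - \<nu>) = real j powr (2 - \<nu>) * real j"
    using assms powr_mult_base[of "real j" "2 - \<nu>"] by (simp add: mult.commute)
  then show ?thesis
    using assms by (simp add: a_coeff_def algebra_simps)
qed

text \<open>The inner coefficients are second differences of powers and telescope; the end
  coefficient cancels all that remains except its tangent term.\<close>

lemma sum_a_coeff:
  assumes "0 < j"
  shows "(\<Sum>m\<le>j. a_coeff \<nu> (int j) (int m)) = (3 - \<nu>) * real j powr (2 - \<nu>)"
proof -
  have inner: "(\<Sum>m=1..<n. a_coeff \<nu> (int j) (int m))
      = real j powr (3 - \<nu>) - (real j - 1) powr (3 - \<nu>) - (real j - n + 1) powr (3 - \<nu>)
        + (real j - n) powr (3 - \<nu>)" if "1 \<le> n" "n \<le> j" for n
    using that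
  proof (induction n rule: dec_induct)
    case (step n)
    then show ?case by (simp add: a_coeff_def algebra_simps)
  qed simp
  have "{..j} = insert 0 (insert j {1..<j})" using assms by auto
  then have "(\<Sum>m\<le>j. a_coeff \<nu> (int j) (int m))
      = a_coeff \<nu> (int j) 0 + 1 + (\<Sum>m=1..<j. a_coeff \<nu> (int j) (int m))"
    using assms by simp
  then show ?thesis using inner[of j] a_coeff_zero[OF assms] assms by simp
qed

text \<open>All cases of the definition become one second difference in the first index, with
  \<open>a_coeff\<close> continued by 0 above the diagonal. Row sums of \<open>p_coeff\<close> thus
  reduce to row sums of \<open>a_coeff\<close>.\<close>

lemma p_coeff_nat:
  assumes "0 < i"
  shows "p_coeff \<nu> (int i) (int m)
    = (if m \<le> i - 1 then a_coeff \<nu> (int (i - 1)) (int m) else 0)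
      - 2 * (if m \<le> i then a_coeff \<nu> (int i) (int m) else 0)
      + (if m \<le> i + 1 then a_coeff \<nu> (int (i + 1)) (int m) else 0)"
proof -
  have eq: "int (i - 1) = int i - 1" "int (i + 1) = int i + 1" using assms by auto
  consider "m \<le> i - 1" | "m = i" | "m = i + 1" | "i + 1 < m" by linarith
  then show ?thesis
    unfolding eq by cases (use assms in \<open>auto simp: p_coeff_def add.commute[of 1 "int i"]\<close>)
qed

lemma p_coeff_super: "p_coeff \<nu> i (i + 1) = 1"
  by (simp add: p_coeff_def)

lemma p_coeff_beyond: "i + 1 < m \<Longrightarrow> p_coeff \<nu> i m = 0"
  by (simp add: p_coeff_def)

lemma p_coeff_zero_zero: "p_coeff \<nu> 0 0 = - \<nu>"
  by (simp add: p_coeff_def a_coeff_def)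

lemma powr_three_minus: "2 powr (3 - \<nu>) = 2 * 2 powr (2 - \<nu>)" for \<nu> :: real
  using powr_mult_base[of 2 "2 - \<nu>"] by simp

lemma p_coeff_diag: "0 < i \<Longrightarrow> p_coeff \<nu> i i = - 2 * (2 - 2 powr (2 - \<nu>))"
  by (simp add: p_coeff_def a_coeff_def powr_three_minus)

lemma p_coeff_one_zero: "p_coeff \<nu> 1 0 = (\<nu> - 1) * (2 - 2 powr (2 - \<nu>))"
  by (simp add: p_coeff_def a_coeff_def algebra_simps)

lemma two_powr_le_two: "1 \<le> \<nu> \<Longrightarrow> 2 powr (2 - \<nu>) \<le> (2::real)"
  using powr_mono[of "2 - \<nu>" 1 "2::real"] by simp

section \<open>Signs of the off-diagonal entries\<close>

lemma p_coeff_zero_nonneg: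
  assumes "0 < i" "1 \<le> \<nu>" "\<nu> \<le> 2"
  shows "0 \<le> p_coeff \<nu> (int i) 0"
proof (cases "i = 1")
  \<comment> \<open>Row 1 involves \<open>a_coeff \<nu> 0 0 = 1\<close>, which the formula of
    \<open>a_coeff_zero\<close> does not cover.\<close>
  case True
  then show ?thesis
    using assms two_powr_le_two[of \<nu>] by (simp add: p_coeff_one_zero)
next
  case False
  define f where "f = (\<lambda>t::real. (t - 1) powr (3 - \<nu>) - t powr (3 - \<nu>) + (3 - \<nu>) * t powr (2 - \<nu>))"
  have "p_coeff \<nu> (int i) (int 0) = a_coeff \<nu> (int (i - 1)) 0 - 2 * a_coeff \<nu> (int i) 0 + a_coeff \<nu> (int (i + 1)) 0"
    using p_coeff_nat[of i \<nu> 0] assms by simp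
  also have "\<dots> = f (real i - 1) - 2 * f (real i) + f (real i + 1)"
    using False assms by (subst (1 2 3) a_coeff_zero) (auto simp: f_def of_nat_diff add.commute)
  also have "\<dots> \<ge> 0"
    using second_difference_end_coeff_nonneg[of "real i" "3 - \<nu>"] False assms by (simp add: f_def)
  finally show ?thesis by simp
qed

lemma p_coeff_far_nonneg:
  assumes "1 \<le> m" "m + 2 \<le> i" "1 \<le> \<nu>" "\<nu> \<le> 2"
  shows "0 \<le> p_coeff \<nu> (int i) (int m)"
proof -
  let ?x = "real i - real m"
  have "p_coeff \<nu> (int i) (int m) = (?x + 2) powr (3 - \<nu>) - 4 * (?x + 1) powr (3 - \<nu>)
      + 6 * ?x powr (3 - \<nu>) - 4 * (?x - 1) powr (3 - \<nu>) + (?x - 2) powr (3 - \<nu>)"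
    using assms by (simp add: p_coeff_def a_coeff_def algebra_simps)
  also have "\<dots> \<ge> 0"
    using assms by (intro fourth_difference_powr_nonneg) auto
  finally show ?thesis .
qed

text \<open>For \<open>\<nu>\<close> near 1 this entry is negative, but the bound suffices: the
  reflected half contributes 1 at the same place.\<close>

lemma p_coeff_sub_ge:
  assumes "0 < i" "1 \<le> \<nu>" "\<nu> \<le> 2"
  shows "- 1 \<le> p_coeff \<nu> (int i) (int i - 1)"
proof (cases "i = 1")
  case True
  then show ?thesis using p_coeff_zero_nonneg[of 1 \<nu>] assms by simp
next
  case False
  then have "p_coeff \<nu> (int i) (int i - 1) = 6 - 4 * 2 powr (3 - \<nu>) + 3 powr (3 - \<nu>)"
    using assms by (simp add: p_coeff_def a_coeff_def)
  then show ?thesis using near_diagonal_bound[of "3 - \<nu>"] assms by simp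
qed

lemma p_coeff_reflect_nonneg:
  assumes "m < i" "i \<le> N" "1 \<le> \<nu>" "\<nu> \<le> 2"
  shows "0 \<le> p_coeff \<nu> (int i) (int m) + p_coeff \<nu> (int (N - i)) (int (N - m))"
proof (cases "m + 1 = i")
  case True
  \<comment> \<open>Below the diagonal by one, the reflected entry lies on the superdiagonal of
    \<open>p_coeff\<close> and equals 1; further away it is 0.\<close>
  then have eq: "int (N - m) = int (N - i) + 1" "int m = int i - 1"
    using assms by auto
  show ?thesis unfolding eq p_coeff_super using p_coeff_sub_ge[of i \<nu>] assms by simp
next
  case False
  then have "p_coeff \<nu> (int (N - i)) (int (N - m)) = 0"
    using assms by (intro p_coeff_beyond) auto
  moreover have "0 \<le> p_coeff \<nu> (int i) (int m)"
    using p_coeff_zero_nonneg[of i \<nu>] p_coeff_far_nonneg[of m i \<nu>] assms False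
    by (cases "m = 0") auto
  ultimately show ?thesis by simp
qed

lemma g_coeff_off_diag_nonneg:
  assumes "1 \<le> \<nu>" "\<nu> \<le> 2" "i \<le> N" "m \<le> N" "m \<noteq> i"
  shows "0 \<le> g_coeff \<nu> N i m"
proof (cases "m < i")
  case True
  then show ?thesis
    using p_coeff_reflect_nonneg[of m i N \<nu>] assms by (simp add: g_coeff_reflect)
next
  case False
  then show ?thesis
    using p_coeff_reflect_nonneg[of "N - m" "N - i" N \<nu>] assms
    by (simp add: g_coeff_reflect add.commute)
qed

section \<open>Row sums of \<open>p_coeff\<close>\<close>

lemma sum_if_le:
  fixes h :: "nat \<Rightarrow> real"
  assumes "j \<le> N"
  shows "(\<Sum>m\<le>N. if m \<le> j then h m else 0) = (\<Sum>m\<le>j. h m)"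
  using assms by (intro sum.mono_neutral_cong_right) auto

lemma sum_p_coeff_zero:
  assumes "0 < N"
  shows "(\<Sum>m\<le>N. p_coeff \<nu> 0 (int m)) = 1 - \<nu>"
proof -
  have "(\<Sum>m\<le>N. p_coeff \<nu> 0 (int m)) = (\<Sum>m\<in>{0, 1}. p_coeff \<nu> 0 (int m))"
    using assms by (intro sum.mono_neutral_right) (auto intro!: p_coeff_beyond)
  then show ?thesis using p_coeff_super[of \<nu> 0] by (simp add: p_coeff_zero_zero)
qed

text \<open>The sum for \<open>i - 1\<close> is left unevaluated: for \<open>i = 1\<close> it is
  \<open>a_coeff \<nu> 0 0 = 1\<close>, outside the scope of \<open>sum_a_coeff\<close>. This is the
  source of the excess in row 1.\<close>

lemma sum_p_coeff:
  assumes "0 < i" "i < N"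
  shows "(\<Sum>m\<le>N. p_coeff \<nu> (int i) (int m))
    = (\<Sum>m\<le>i - 1. a_coeff \<nu> (int (i - 1)) (int m))
      + (3 - \<nu>) * ((real i + 1) powr (2 - \<nu>) - 2 * real i powr (2 - \<nu>))"
proof -
  have "(\<Sum>m\<le>N. p_coeff \<nu> (int i) (int m))
    = (\<Sum>m\<le>i - 1. a_coeff \<nu> (int (i - 1)) (int m))
      - 2 * (\<Sum>m\<le>i. a_coeff \<nu> (int i) (int m)) + (\<Sum>m\<le>i + 1. a_coeff \<nu> (int (i + 1)) (int m))"
    using assms by (simp only: p_coeff_nat sum.distrib sum_subtractf sum_distrib_left[symmetric] sum_if_le)
  then show ?thesis
    using assms by (simp only: sum_a_coeff) (simp add: algebra_simps)
qed

text \<open>In row \<open>N\<close> the superdiagonal entry 1 falls outside the grid.\<close>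

lemma sum_p_coeff_last:
  assumes "0 < N"
  shows "(\<Sum>m\<le>N. p_coeff \<nu> (int N) (int m)) = (\<Sum>m\<le>N + 1. p_coeff \<nu> (int N) (int m)) - 1"
  using p_coeff_super[of \<nu> "int N"] by (simp add: add.commute)

lemma sum_p_coeff_one:
  assumes "1 < N"
  shows "(\<Sum>m\<le>N. p_coeff \<nu> 1 (int m)) = 1 - (3 - \<nu>) * (2 - 2 powr (2 - \<nu>))"
  using sum_p_coeff[of 1 N \<nu>] assms by (simp add: algebra_simps)

text \<open>For \<open>i > 1\<close> the row sum is \<open>3 - \<nu>\<close> times a second
  difference of the concave function \<open>t powr (2 - \<nu>)\<close>.\<close>

lemma sum_p_coeff_nonpos:
  assumes "1 < i" "i < N" "1 \<le> \<nu>" "\<nu> \<le> 2"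
  shows "(\<Sum>m\<le>N. p_coeff \<nu> (int i) (int m)) \<le> 0"
proof -
  let ?x = "real (i - 1)"
  have x: "real i = ?x + 1" "0 < ?x" using assms by auto
  have "(\<Sum>m\<le>N. p_coeff \<nu> (int i) (int m))
      = (3 - \<nu>) * (?x powr (2 - \<nu>) - 2 * (?x + 1) powr (2 - \<nu>) + (?x + 2) powr (2 - \<nu>))"
    using sum_p_coeff[of i N \<nu>] sum_a_coeff[of "i - 1" \<nu>] assms x
    by (simp add: algebra_simps del: of_nat_diff)
  also have "\<dots> \<le> 0"
    using assms x(2) by (intro mult_nonneg_nonpos second_difference_powr_nonpos) auto
  finally show ?thesis .
qed

text \<open>
  With \<open>r = 2 - 2 powr (2 - \<nu>)\<close>, the weighted sum of row \<open>0\<close> is at most \<open>(1 - \<eta>) (\<nu> + 2 r) - \<nu>\<close> for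
  the end weight \<open>\<eta>\<close>.  The value below makes this bound zero, and then the excess of row \<open>1\<close> is
  compensated as well.
\<close>

definition end_weight :: "real \<Rightarrow> real" where
  "end_weight \<nu> = 2 * (2 - 2 powr (2 - \<nu>)) / (\<nu> + 2 * (2 - 2 powr (2 - \<nu>)))"

definition node_weight :: "real \<Rightarrow> nat \<Rightarrow> nat \<Rightarrow> real" where
  "node_weight \<nu> N m = (if m = 0 \<or> m = N then end_weight \<nu> else 1)"

text \<open>Positivity comes from \<open>2 - 2 powr (2 - \<nu>) > 0\<close>, that is, from
  \<open>\<nu> > 1\<close>.\<close>

lemma end_weight_bounds:
  assumes "1 < \<nu>"
  shows "0 < end_weight \<nu>" "end_weight \<nu> \<le> 1"
proof -
  have "2 powr (2 - \<nu>) < (2::real)"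
    using powr_less_mono[of "2 - \<nu>" 1 "2::real"] assms by simp
  then show "0 < end_weight \<nu>" "end_weight \<nu> \<le> 1"
    using assms by (auto simp: end_weight_def divide_simps)
qed

lemma node_weight_bounds:
  assumes "1 < \<nu>"
  shows "end_weight \<nu> \<le> node_weight \<nu> N m" "node_weight \<nu> N m \<le> 1" "0 < node_weight \<nu> N m"
  using end_weight_bounds[OF assms] by (auto simp: node_weight_def)

lemma node_weight_reflect: "m \<le> N \<Longrightarrow> node_weight \<nu> N (N - m) = node_weight \<nu> N m"
  by (auto simp: node_weight_def)

lemma sum_node_weight:
  assumes "0 < N"
  shows "(\<Sum>m\<le>N. h m * node_weight \<nu> N m) = (\<Sum>m\<le>N. h m) - (1 - end_weight \<nu>) * (h 0 + h N)"
proof -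
  have eq: "{..N} = insert 0 (insert N {0<..<N})" using assms by auto
  have "(\<Sum>m\<in>{0<..<N}. h m * node_weight \<nu> N m) = (\<Sum>m\<in>{0<..<N}. h m)"
    by (intro sum.cong) (auto simp: node_weight_def)
  then show ?thesis
    using assms unfolding eq by (simp add: node_weight_def algebra_simps)
qed

text \<open>Row 1 may exceed 0 by \<open>1 - end_weight \<nu>\<close>, while row
  \<open>N - 1\<close> gains the same amount because its superdiagonal entry 1 meets the lowered end
  weight. Reflection exchanges the two rows, so the terms will cancel.\<close>

lemma sum_p_coeff_node_weight_inner:
  assumes "0 < i" "i < N" "1 < \<nu>" "\<nu> \<le> 2"
  shows "(\<Sum>m\<le>N. p_coeff \<nu> (int i) (int m) * node_weight \<nu> N m)
    \<le> (1 - end_weight \<nu>) * ((if i = 1 then 1 else 0) - (if i = N - 1 then 1 else 0))"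
proof -
  let ?d = "1 - end_weight \<nu>"
  have d: "0 \<le> ?d" using end_weight_bounds[OF assms(3)] by simp
  have pN: "p_coeff \<nu> (int i) (int N) = (if i = N - 1 then 1 else 0)"
  proof (cases "i = N - 1")
    case True
    then have "int N = int i + 1" using assms by auto
    then have "p_coeff \<nu> (int i) (int N) = 1" by (simp only: p_coeff_super)
    then show ?thesis unfolding if_P[OF True] .
  next
    case False
    then show ?thesis using assms by (simp add: p_coeff_beyond)
  qed
  have "(\<Sum>m\<le>N. p_coeff \<nu> (int i) (int m)) - ?d * p_coeff \<nu> (int i) 0 \<le> (if i = 1 then ?d else 0)"
  proof (cases "i = 1")
    case True
    define r where "r = 2 - 2 powr (2 - \<nu>)"
    have r: "0 \<le> r" using two_powr_le_two[of \<nu>] assms by (simp add: r_def)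
    define X where "X = \<nu> + 2 * r"
    have X: "0 < X" using r assms by (simp add: X_def)
    have d_eq: "?d = \<nu> / X"
      using X by (simp add: end_weight_def r_def[symmetric] X_def[symmetric] diff_divide_eq_iff)
        (simp add: X_def)
    \<comment> \<open>This product is exactly \<open>\<nu>\<close> minus the left-hand side of the
      next inequality, which is the claim for row 1 multiplied by \<open>X\<close>.\<close>
    have "0 \<le> 2 * r * (r * (3 - \<nu>) + (\<nu> - 1))"
      using r assms by (intro mult_nonneg_nonneg add_nonneg_nonneg) auto
    then have "(1 - (3 - \<nu>) * r) * X - \<nu> * ((\<nu> - 1) * r) \<le> \<nu>"
      by (simp add: X_def algebra_simps)
    then have "((1 - (3 - \<nu>) * r) * X - \<nu> * ((\<nu> - 1) * r)) / X \<le> \<nu> / X"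
      using X by (intro divide_right_mono) auto
    then have "1 - (3 - \<nu>) * r - ?d * ((\<nu> - 1) * r) \<le> ?d"
      unfolding d_eq using X by (simp add: diff_divide_distrib)
    moreover have "(\<Sum>m\<le>N. p_coeff \<nu> 1 (int m)) = 1 - (3 - \<nu>) * r"
      using sum_p_coeff_one[of N \<nu>] True assms by (simp only: r_def)
    ultimately show ?thesis
      unfolding True of_nat_1 p_coeff_one_zero r_def[symmetric] by simp
  next
    case False
    then have "(\<Sum>m\<le>N. p_coeff \<nu> (int i) (int m)) \<le> 0"
      using assms by (intro sum_p_coeff_nonpos) auto
    moreover have "0 \<le> ?d * p_coeff \<nu> (int i) 0"
      using d assms by (intro mult_nonneg_nonneg p_coeff_zero_nonneg) auto
    ultimately show ?thesis using False by simp
  qed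
  moreover have "(\<Sum>m\<le>N. p_coeff \<nu> (int i) (int m) * node_weight \<nu> N m)
      = (\<Sum>m\<le>N. p_coeff \<nu> (int i) (int m)) - ?d * p_coeff \<nu> (int i) 0
        - ?d * (if i = N - 1 then 1 else 0)"
    using assms by (subst sum_node_weight) (simp_all only: pN of_nat_0 distrib_left diff_diff_eq)
  ultimately show ?thesis
    by (simp only: right_diff_distrib) (simp split: if_splits)
qed

text \<open>For either end row of \<open>g_coeff\<close>, rows 0 and \<open>N\<close> of
  \<open>p_coeff\<close> are added. Row \<open>N\<close> has plain sum at most -1, and the choice of
  \<open>end_weight\<close> cancels everything but
  \<open>- ?d * p_coeff \<nu> (int N) 0\<close>.\<close>

lemma sum_p_coeff_node_weight_ends:
  assumes "1 < N" "1 < \<nu>" "\<nu> \<le> 2"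
  shows "(\<Sum>m\<le>N. p_coeff \<nu> 0 (int m) * node_weight \<nu> N m)
    + (\<Sum>m\<le>N. p_coeff \<nu> (int N) (int m) * node_weight \<nu> N m) \<le> 0"
proof -
  let ?d = "1 - end_weight \<nu>"
  define r where "r = 2 - 2 powr (2 - \<nu>)"
  have r: "0 \<le> r" using two_powr_le_two[of \<nu>] assms by (simp add: r_def)
  have "0 \<le> ?d" using end_weight_bounds[OF assms(2)] by simp
  then have p0: "0 \<le> ?d * p_coeff \<nu> (int N) 0"
    using p_coeff_zero_nonneg[of N \<nu>] assms by simp
  have dr: "?d * (\<nu> + 2 * r) = \<nu>"
    using r assms by (simp add: end_weight_def r_def[symmetric] field_simps)
  have "(\<Sum>m\<le>N. p_coeff \<nu> 0 (int m) * node_weight \<nu> N m) = 1 - \<nu> + ?d * \<nu>"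
    using assms sum_p_coeff_zero[of N \<nu>]
    by (simp add: sum_node_weight p_coeff_zero_zero p_coeff_beyond)
  moreover have "(\<Sum>m\<le>N. p_coeff \<nu> (int N) (int m) * node_weight \<nu> N m)
      = (\<Sum>m\<le>N. p_coeff \<nu> (int N) (int m)) - ?d * (p_coeff \<nu> (int N) 0 - 2 * r)"
    using assms by (subst sum_node_weight) (simp_all add: p_coeff_diag r_def)
  moreover have "(\<Sum>m\<le>N. p_coeff \<nu> (int N) (int m)) \<le> - 1"
  proof -
    have "(\<Sum>m\<le>N + 1. p_coeff \<nu> (int N) (int m)) \<le> 0"
      using assms by (intro sum_p_coeff_nonpos) auto
    moreover have "0 < N" using assms by simp
    ultimately show ?thesis using sum_p_coeff_last[of N \<nu>] by linarith
  qed
  moreover have "1 - \<nu> + ?d * \<nu> - 1 - ?d * (p_coeff \<nu> (int N) 0 - 2 * r)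
      = ?d * (\<nu> + 2 * r) - \<nu> - ?d * p_coeff \<nu> (int N) 0"
    by (simp add: algebra_simps)
  ultimately show ?thesis
    using p0 dr by linarith
qed

lemma sum_g_coeff_node_weight:
  assumes "i \<le> N"
  shows "(\<Sum>m\<le>N. g_coeff \<nu> N i m * node_weight \<nu> N m)
    = (\<Sum>m\<le>N. p_coeff \<nu> (int i) (int m) * node_weight \<nu> N m)
      + (\<Sum>m\<le>N. p_coeff \<nu> (int (N - i)) (int m) * node_weight \<nu> N m)"
proof -
  have "(\<Sum>m\<le>N. g_coeff \<nu> N i m * node_weight \<nu> N m)
    = (\<Sum>m\<le>N. p_coeff \<nu> (int i) (int m) * node_weight \<nu> N m)
      + (\<Sum>m\<le>N. p_coeff \<nu> (int (N - i)) (int (N - m)) * node_weight \<nu> N (N - m))"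
    unfolding sum.distrib[symmetric]
    by (intro sum.cong) (use assms in \<open>auto simp: g_coeff_reflect node_weight_reflect distrib_right\<close>)
  also have "(\<Sum>m\<le>N. p_coeff \<nu> (int (N - i)) (int (N - m)) * node_weight \<nu> N (N - m))
    = (\<Sum>m\<le>N. p_coeff \<nu> (int (N - i)) (int m) * node_weight \<nu> N m)"
    by (rule sum.reindex_bij_witness[of _ "\<lambda>m. N - m" "\<lambda>m. N - m"]) auto
  finally show ?thesis .
qed

lemma sum_g_coeff_node_weight_nonpos:
  assumes "0 < N" "i \<le> N" "1 < \<nu>" "\<nu> \<le> 2"
  shows "(\<Sum>m\<le>N. g_coeff \<nu> N i m * node_weight \<nu> N m) \<le> 0"
proof -
  consider "N = 1" | "1 < N" "i = 0 \<or> i = N" | "0 < i" "i < N" using assms by linarith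
  then show ?thesis
  proof cases
    \<comment> \<open>Both nodes are end nodes, so the common weight factors out of the sum.\<close>
    case 1
    have last: "(\<Sum>m\<le>1. p_coeff \<nu> (int 1) (int m)) = - ((3 - \<nu>) * (2 - 2 powr (2 - \<nu>)))"
      using sum_p_coeff_last[of 1 \<nu>] sum_p_coeff_one[of "1 + 1" \<nu>] by (simp only: of_nat_1)
    have "(\<Sum>m\<le>1. g_coeff \<nu> 1 i m * node_weight \<nu> 1 m)
        = end_weight \<nu> * ((\<Sum>m\<le>1. p_coeff \<nu> 0 (int m)) + (\<Sum>m\<le>1. p_coeff \<nu> (int 1) (int m)))"
      using assms 1 by (cases "i = 0")
        (auto simp: g_coeff_reflect node_weight_def le_Suc_eq algebra_simps)
    also have "\<dots> = - end_weight \<nu> * (\<nu> - 1 + (3 - \<nu>) * (2 - 2 powr (2 - \<nu>)))"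
      unfolding last sum_p_coeff_zero[OF zero_less_one] by (simp add: algebra_simps)
    also have "\<dots> \<le> 0"
      using end_weight_bounds[of \<nu>] two_powr_le_two[of \<nu>] assms
      by (intro mult_nonpos_nonneg add_nonneg_nonneg mult_nonneg_nonneg) auto
    finally show ?thesis using 1 by simp
  next
    case 2
    then show ?thesis
      using sum_p_coeff_node_weight_ends[of N \<nu>] assms by (auto simp: sum_g_coeff_node_weight)
  next
    case 3
    have "(\<Sum>m\<le>N. g_coeff \<nu> N i m * node_weight \<nu> N m)
      \<le> (1 - end_weight \<nu>) * ((if i = 1 then 1 else 0) - (if i = N - 1 then 1 else 0))
        + (1 - end_weight \<nu>) * ((if N - i = 1 then 1 else 0) - (if N - i = N - 1 then 1 else 0))"
      unfolding sum_g_coeff_node_weight[OF assms(2)]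
      using 3 assms by (intro add_mono sum_p_coeff_node_weight_inner) auto
    \<comment> \<open>\<open>N - i = 1\<close> means \<open>i = N - 1\<close>, and
      \<open>N - i = N - 1\<close> means \<open>i = 1\<close>.\<close>
    also have "\<dots> = 0" using 3 by auto
    finally show ?thesis .
  qed
qed

section \<open>The weighted maximum principle\<close>

text \<open>At a node where the weighted modulus of \<open>e\<close> attains its maximum
  \<open>M\<close>, nonnegative off-diagonal entries and nonpositive weighted row sums make both
  spatial terms work against the sign of \<open>e\<close>. Hence \<open>M\<close> is bounded by the
  data there, or is 0 outside \<open>S\<close>.\<close>

lemma weighted_max_principle:
  fixes e :: "nat \<Rightarrow> nat \<Rightarrow> real"
  assumes off: "\<And>i j. (i, j) \<in> all_nodes Nx Ny - S \<Longrightarrow> e i j = 0"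
    and eq: "\<And>i j. (i, j) \<in> all_nodes Nx Ny \<inter> S \<Longrightarrow> e i j = r i j
        + a i j * (\<Sum>m\<le>Nx. G i m * e m j) + b i j * (\<Sum>m\<le>Ny. H j m * e i m)"
    and ab: "\<And>i j. (i, j) \<in> all_nodes Nx Ny \<Longrightarrow> 0 \<le> a i j \<and> 0 \<le> b i j"
    and r: "\<And>i j. (i, j) \<in> all_nodes Nx Ny \<inter> S \<Longrightarrow> \<bar>r i j\<bar> \<le> E * (w i * z j)"
    and G: "\<And>i m. i \<le> Nx \<Longrightarrow> m \<le> Nx \<Longrightarrow> m \<noteq> i \<Longrightarrow> 0 \<le> G i m"
    and H: "\<And>j m. j \<le> Ny \<Longrightarrow> m \<le> Ny \<Longrightarrow> m \<noteq> j \<Longrightarrow> 0 \<le> H j m"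
    and Gw: "\<And>i. i \<le> Nx \<Longrightarrow> (\<Sum>m\<le>Nx. G i m * w m) \<le> 0"
    and Hz: "\<And>j. j \<le> Ny \<Longrightarrow> (\<Sum>m\<le>Ny. H j m * z m) \<le> 0"
    and w: "\<And>i. 0 < w i" and z: "\<And>j. 0 < z j" and E: "0 \<le> E"
    and ij: "(i, j) \<in> all_nodes Nx Ny"
  shows "\<bar>e i j\<bar> \<le> E * (w i * z j)"
proof -
  define q where "q = (\<lambda>(i, j). \<bar>e i j\<bar> / (w i * z j))"
  define M where "M = Max (q ` all_nodes Nx Ny)"
  have fin: "finite (all_nodes Nx Ny)" by (simp add: all_nodes_def)
  have wz: "0 < w i * z j" for i j using w z by simp
  have le_M: "\<bar>e i j\<bar> \<le> M * (w i * z j)" if "(i, j) \<in> all_nodes Nx Ny" for i j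
  proof -
    have "q (i, j) \<le> M" unfolding M_def using fin that by (intro Max_ge) auto
    then show ?thesis by (simp add: q_def pos_divide_le_eq wz)
  qed
  have "M \<in> q ` all_nodes Nx Ny"
    unfolding M_def using fin ij by (intro Max_in) auto
  then obtain i0 j0 where node: "(i0, j0) \<in> all_nodes Nx Ny" and M: "M = q (i0, j0)" by auto
  have "M \<le> E"
  proof (cases "(i0, j0) \<in> S")
    case False
    then show ?thesis using off[of i0 j0] node M E by (simp add: q_def)
  next
    case True
    have le: "i0 \<le> Nx" "j0 \<le> Ny" using node by (auto simp: all_nodes_def)
    define s where "s = sgn (e i0 j0)"
    have s_le: "s * x \<le> \<bar>x\<bar>" for x
      unfolding s_def by (auto simp: sgn_if)
    have se: "s * e i0 j0 = M * (w i0 * z j0)"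
      using w[of i0] z[of j0] abs_sgn[of "e i0 j0"]
      by (simp add: s_def M q_def mult.commute[of "sgn (e i0 j0)"] less_imp_neq[symmetric])
    have M0: "0 \<le> M" using wz[of i0 j0] by (simp add: M q_def)
    have 1: "s * (\<Sum>m\<le>Nx. G i0 m * e m j0) \<le> 0"
    proof -
      have "s * (\<Sum>m\<le>Nx. G i0 m * e m j0) = (\<Sum>m\<le>Nx. G i0 m * (s * e m j0))"
        by (simp add: sum_distrib_left mult_ac)
      also have "\<dots> \<le> (\<Sum>m\<le>Nx. G i0 m * (M * (w m * z j0)))"
      proof (rule sum_mono)
        fix m assume m: "m \<in> {..Nx}"
        show "G i0 m * (s * e m j0) \<le> G i0 m * (M * (w m * z j0))"
        \<comment> \<open>On the diagonal \<open>se\<close> gives equality, so the sign of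
          \<open>G i0 i0\<close> does not matter.\<close>
        proof (cases "m = i0")
          case False
          have "s * e m j0 \<le> M * (w m * z j0)"
            using s_le[of "e m j0"] le_M[of m j0] m le by (force simp: all_nodes_def)
          then show ?thesis using G[of i0 m] m le False by (simp add: mult_left_mono)
        qed (simp add: se)
      qed
      also have "\<dots> = M * z j0 * (\<Sum>m\<le>Nx. G i0 m * w m)"
        by (simp add: sum_distrib_left mult_ac)
      also have "\<dots> \<le> 0"
        using M0 z[of j0] Gw[OF le(1)] by (intro mult_nonneg_nonpos) auto
      finally show ?thesis .
    qed
    have 2: "s * (\<Sum>m\<le>Ny. H j0 m * e i0 m) \<le> 0"
    proof -
      have "s * (\<Sum>m\<le>Ny. H j0 m * e i0 m) = (\<Sum>m\<le>Ny. H j0 m * (s * e i0 m))"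
        by (simp add: sum_distrib_left mult_ac)
      also have "\<dots> \<le> (\<Sum>m\<le>Ny. H j0 m * (M * (w i0 * z m)))"
      proof (rule sum_mono)
        fix m assume m: "m \<in> {..Ny}"
        show "H j0 m * (s * e i0 m) \<le> H j0 m * (M * (w i0 * z m))"
        proof (cases "m = j0")
          case False
          have "s * e i0 m \<le> M * (w i0 * z m)"
            using s_le[of "e i0 m"] le_M[of i0 m] m le by (force simp: all_nodes_def)
          then show ?thesis using H[of j0 m] m le False by (simp add: mult_left_mono)
        qed (simp add: se)
      qed
      also have "\<dots> = M * w i0 * (\<Sum>m\<le>Ny. H j0 m * z m)"
        by (simp add: sum_distrib_left mult_ac)
      also have "\<dots> \<le> 0"
        using M0 w[of i0] Hz[OF le(2)] by (intro mult_nonneg_nonpos) auto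
      finally show ?thesis .
    qed
    have "M * (w i0 * z j0) = s * r i0 j0 + a i0 j0 * (s * (\<Sum>m\<le>Nx. G i0 m * e m j0))
        + b i0 j0 * (s * (\<Sum>m\<le>Ny. H j0 m * e i0 m))"
      unfolding se[symmetric] by (subst eq) (use node True in \<open>auto simp: algebra_simps\<close>)
    also have "\<dots> \<le> \<bar>r i0 j0\<bar> + 0 + 0"
      using s_le[of "r i0 j0"] mult_nonneg_nonpos[OF _ 1] mult_nonneg_nonpos[OF _ 2] ab[OF node]
      by (intro add_mono) auto
    also have "\<dots> \<le> E * (w i0 * z j0)" using r[of i0 j0] node True by simp
    finally show ?thesis using wz[of i0 j0] mult_right_le_imp_le by blast
  qed
  then have "M * (w i * z j) \<le> E * (w i * z j)"
    using wz[of i j] by (intro mult_right_mono) auto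
  with le_M[OF ij] show ?thesis by linarith
qed

section \<open>Stability\<close>

lemma l_coeff_zero: "l_coeff \<gamma> 0 = 1"
  by (simp add: l_coeff_def)

lemma l_coeff_nonneg: "0 < \<gamma> \<Longrightarrow> \<gamma> \<le> 1 \<Longrightarrow> 0 \<le> l_coeff \<gamma> s"
  by (auto simp: l_coeff_def intro!: powr_mono2)

text \<open>For \<open>\<gamma> < 1\<close> this is concavity of
  \<open>t powr (1 - \<gamma>)\<close>; for \<open>\<gamma> = 1\<close> it is read off the
  definition.\<close>

lemma l_coeff_antimono:
  assumes "0 < \<gamma>" "\<gamma> \<le> 1"
  shows "l_coeff \<gamma> (s + 1) \<le> l_coeff \<gamma> s"
  using second_difference_powr_nonpos[of "real s" "1 - \<gamma>"] assms
  by (auto simp: l_coeff_def add_ac)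

lemma riesz_kappa_nonpos:
  assumes "1 < \<nu>" "\<nu> \<le> 2"
  shows "riesz_kappa \<nu> \<le> 0"
proof -
  have "cos (\<nu> * pi / 2) = - cos (pi - \<nu> * pi / 2)" by (simp add: cos_diff)
  moreover have "0 \<le> cos (pi - \<nu> * pi / 2)"
    using assms by (intro cos_ge_zero) (auto simp: field_simps)
  ultimately show ?thesis by (simp add: riesz_kappa_def divide_nonneg_nonpos)
qed

section \<open>Mesh nodes and diffusion numbers\<close>

lemma equispaced_node_mem:
  fixes a b :: real
  assumes "a \<le> b" "i \<le> N"
  shows "a + real i * ((b - a) / real N) \<in> {a..b}"
proof -
  have "real i * ((b - a) / real N) \<le> real N * ((b - a) / real N)"
    using assms by (intro mult_right_mono) auto
  also have "\<dots> \<le> b - a" using assms by simp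
  finally show ?thesis using assms by auto
qed

lemma node_x_mem: "xL P < xR P \<Longrightarrow> i \<le> Nx \<Longrightarrow> node_x P Nx i \<in> {xL P..xR P}"
  unfolding node_x_def step_x_def by (intro equispaced_node_mem) auto

lemma node_y_mem: "yL P < yR P \<Longrightarrow> j \<le> Ny \<Longrightarrow> node_y P Ny j \<in> {yL P..yR P}"
  unfolding node_y_def step_y_def by (intro equispaced_node_mem) auto

lemma node_t_mem: "0 < Tend P \<Longrightarrow> 0 < n \<Longrightarrow> n \<le> Nt \<Longrightarrow> node_t P Nt n \<in> {0<..Tend P}"
  by (auto simp: node_t_def step_t_def field_simps)

text \<open>The minus sign meets \<open>riesz_kappa \<nu> \<le> 0\<close>. No relation between
  \<open>\<tau>\<close> and \<open>h\<close> enters, which is why stability is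
  unconditional.\<close>

lemma diffusion_number_nonneg:
  assumes "\<gamma> \<le> 1" "1 < \<nu>" "\<nu> \<le> 2" "0 \<le> c"
  shows "0 \<le> - (Gamma (2 - \<gamma>) * \<tau> powr \<gamma> * riesz_kappa \<nu> * c) / (Gamma (4 - \<nu>) * h powr \<nu>)"
proof -
  have "0 \<le> Gamma (2 - \<gamma>) * \<tau> powr \<gamma>" "0 \<le> Gamma (4 - \<nu>) * h powr \<nu>"
    using assms by (auto intro!: mult_nonneg_nonneg Gamma_real_nonneg)
  moreover from this(1) have "Gamma (2 - \<gamma>) * \<tau> powr \<gamma> * riesz_kappa \<nu> * c \<le> 0"
    using assms riesz_kappa_nonpos[of \<nu>] by (intro mult_nonpos_nonneg mult_nonneg_nonpos) auto
  ultimately show ?thesis by (intro divide_nonneg_nonneg) auto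
qed

lemma omega_x_nonneg:
  assumes "gam P \<le> 1" "1 < alpha P" "alpha P \<le> 2"
    and "0 \<le> cx P (node_x P Nx i) (node_y P Ny j) (node_t P Nt n)"
  shows "0 \<le> omega_x P Nx Ny Nt i j n"
  unfolding omega_x_def using assms by (rule diffusion_number_nonneg)

lemma omega_y_nonneg:
  assumes "gam P \<le> 1" "1 < beta P" "beta P \<le> 2"
    and "0 \<le> dy P (node_x P Nx i) (node_y P Ny j) (node_t P Nt n)"
  shows "0 \<le> omega_y P Nx Ny Nt i j n"
  unfolding omega_y_def using assms by (rule diffusion_number_nonneg)

text \<open>Returning the diagonal terms to the sums gives the equation the shape required by
  \<open>weighted_max_principle\<close>.\<close>

lemma scheme_eq_iff:
  assumes "i \<le> Nx" "j \<le> Ny"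
  shows "scheme_eq P Nx Ny Nt u k i j \<longleftrightarrow>
    u (k + 1) i j = scheme_rhs P Nx Ny Nt u k i j
      + omega_x P Nx Ny Nt i j (k + 1) * (\<Sum>m\<le>Nx. g_coeff (alpha P) Nx i m * u (k + 1) m j)
      + omega_y P Nx Ny Nt i j (k + 1) * (\<Sum>m\<le>Ny. g_coeff (beta P) Ny j m * u (k + 1) i m)"
proof -
  have "(\<Sum>m\<le>Nx. g_coeff (alpha P) Nx i m * u (k + 1) m j)
      = g_coeff (alpha P) Nx i i * u (k + 1) i j
        + (\<Sum>m\<in>{0..Nx} - {i}. g_coeff (alpha P) Nx i m * u (k + 1) m j)"
    using assms by (simp add: atMost_atLeast0 sum.remove[of _ i])
  moreover have "(\<Sum>m\<le>Ny. g_coeff (beta P) Ny j m * u (k + 1) i m)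
      = g_coeff (beta P) Ny j j * u (k + 1) i j
        + (\<Sum>m\<in>{0..Ny} - {j}. g_coeff (beta P) Ny j m * u (k + 1) i m)"
    using assms by (simp add: atMost_atLeast0 sum.remove[of _ j])
  ultimately show ?thesis
    unfolding scheme_eq_def by (auto simp: algebra_simps)
qed

lemma scheme_solution_eq:
  assumes "scheme_solution P Nx Ny Nt S u0 u" "k < Nt" "(i, j) \<in> S"
  shows "scheme_eq P Nx Ny Nt u k i j"
proof -
  have "\<forall>(i, j)\<in>S. scheme_eq P Nx Ny Nt u k i j"
    using assms(1,2) by (simp add: scheme_solution_def)
  then show ?thesis using assms(3) by blast
qed

lemma scheme_solution_bdry:
  assumes "scheme_solution P Nx Ny Nt S u0 u" "k \<le> Nt" "(i, j) \<in> all_nodes Nx Ny - S"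
  shows "u k i j = bdry P (node_x P Nx i) (node_y P Ny j) (node_t P Nt k)"
proof -
  have "\<forall>(i, j)\<in>all_nodes Nx Ny - S. u k i j = bdry P (node_x P Nx i) (node_y P Ny j) (node_t P Nt k)"
    using assms(1,2) unfolding scheme_solution_def by blast
  from bspec[OF this assms(3)] show ?thesis by simp
qed

text \<open>The sum over \<open>s < k\<close> is empty for \<open>k = 0\<close>, and
  \<open>l_coeff \<gamma> 0 = 1\<close>, so one formula covers the first step and all later
  ones.\<close>

definition memory_term :: "real \<Rightarrow> (nat \<Rightarrow> real) \<Rightarrow> nat \<Rightarrow> real" where
  "memory_term \<gamma> e k = (\<Sum>s<k. (l_coeff \<gamma> s - l_coeff \<gamma> (s + 1)) * e (k - s)) + l_coeff \<gamma> k * e 0"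

lemma scheme_rhs_memory:
  "scheme_rhs P Nx Ny Nt u k i j = memory_term (gam P) (\<lambda>n. u n i j) k
    + mu_factor P Nt * src P (node_x P Nx i) (node_y P Ny j) (node_t P Nt (k + 1))"
proof (cases k)
  case (Suc n)
  then have "{0..k - 1} = {..<k}" by auto
  with Suc show ?thesis by (simp add: scheme_rhs_def memory_term_def)
qed (simp add: scheme_rhs_def memory_term_def l_coeff_zero)

lemma memory_term_diff:
  "memory_term \<gamma> f k - memory_term \<gamma> g k = memory_term \<gamma> (\<lambda>n. f n - g n) k"
  by (simp add: memory_term_def right_diff_distrib sum_subtractf)

text \<open>The coefficients are nonnegative and telescope to \<open>l_coeff \<gamma> 0 = 1\<close>:
  the term is a convex combination of earlier values.\<close>

lemma memory_term_bound:
  assumes "0 < \<gamma>" "\<gamma> \<le> 1" and le: "\<And>n. n \<le> k \<Longrightarrow> \<bar>e n\<bar> \<le> B"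
  shows "\<bar>memory_term \<gamma> e k\<bar> \<le> B"
proof -
  have "\<bar>memory_term \<gamma> e k\<bar>
      \<le> (\<Sum>s<k. \<bar>(l_coeff \<gamma> s - l_coeff \<gamma> (s + 1)) * e (k - s)\<bar>) + \<bar>l_coeff \<gamma> k * e 0\<bar>"
    unfolding memory_term_def by (intro order_trans[OF abs_triangle_ineq] add_mono sum_abs order_refl)
  also have "\<dots> \<le> (\<Sum>s<k. (l_coeff \<gamma> s - l_coeff \<gamma> (s + 1)) * B) + l_coeff \<gamma> k * B"
    using l_coeff_antimono[OF assms(1,2)] l_coeff_nonneg[OF assms(1,2)] le
    by (intro add_mono sum_mono) (auto simp: abs_mult intro!: mult_left_mono)
  also have "\<dots> = ((\<Sum>s<k. l_coeff \<gamma> s - l_coeff \<gamma> (Suc s)) + l_coeff \<gamma> k) * B"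
    by (simp add: sum_distrib_right distrib_right)
  also have "\<dots> = B"
    by (simp add: sum_lessThan_telescope' l_coeff_zero)
  finally show ?thesis .
qed

text \<open>The node set is arbitrary: where no equation is imposed, both solutions share the
  boundary values and the error vanishes. The constant depends on \<open>alpha P\<close> and
  \<open>beta P\<close> only.\<close>

lemma unconditionally_stable_cr_scheme:
  fixes P :: cr_problem
  assumes gam: "0 < gam P" "gam P \<le> 1"
    and alpha: "1 < alpha P" "alpha P \<le> 2"
    and beta: "1 < beta P" "beta P \<le> 2"
    and dom: "xL P < xR P" "yL P < yR P" "0 < Tend P"
    and cx: "\<And>x y t. x \<in> {xL P..xR P} \<Longrightarrow> y \<in> {yL P..yR P} \<Longrightarrow> t \<in> {0<..Tend P} \<Longrightarrow> 0 \<le> cx P x y t"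
    and dy: "\<And>x y t. x \<in> {xL P..xR P} \<Longrightarrow> y \<in> {yL P..yR P} \<Longrightarrow> t \<in> {0<..Tend P} \<Longrightarrow> 0 \<le> dy P x y t"
  shows "unconditionally_stable P nodes"
proof -
  define K where "K = 1 / (end_weight (alpha P) * end_weight (beta P))"
  have ends: "0 < end_weight (alpha P) * end_weight (beta P)"
    using end_weight_bounds alpha beta by simp
  then have K: "0 < K" by (simp add: K_def)
  have "grid_max_norm Nx Ny (\<lambda>i j. v k i j - u k i j)
      \<le> K * grid_max_norm Nx Ny (\<lambda>i j. v 0 i j - u 0 i j)"
    if N: "0 < Nx" "0 < Ny" "0 < Nt"
      and u: "scheme_solution P Nx Ny Nt (nodes Nx Ny) u0 u"
      and v: "scheme_solution P Nx Ny Nt (nodes Nx Ny) v0 v" and k: "k \<le> Nt"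
    for Nx Ny Nt u0 v0 u v k
  proof -
    define S where "S = nodes Nx Ny"
    define e where "e = (\<lambda>k i j. v k i j - u k i j)"
    define w where "w = node_weight (alpha P) Nx"
    define z where "z = node_weight (beta P) Ny"
    \<comment> \<open>The factor \<open>K\<close> makes the weighted bound true at level 0, as
      \<open>w i * z j\<close> is at least the product of the two end weights.\<close>
    define E where "E = K * grid_max_norm Nx Ny (e 0)"
    note w_bounds = node_weight_bounds[OF alpha(1), of Nx, folded w_def]
    note z_bounds = node_weight_bounds[OF beta(1), of Ny, folded z_def]
    have fin: "finite (all_nodes Nx Ny)" by (simp add: all_nodes_def)
    have ge_norm: "\<bar>e 0 i j\<bar> \<le> grid_max_norm Nx Ny (e 0)" if "(i, j) \<in> all_nodes Nx Ny" for i j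
      unfolding grid_max_norm_def using that fin by (intro Max_ge) force+
    have "(0, 0) \<in> all_nodes Nx Ny" by (simp add: all_nodes_def)
    from ge_norm[OF this] K have E: "0 \<le> E" unfolding E_def by simp
    \<comment> \<open>Strong induction, since the memory term reaches back to all earlier levels.
      \<open>E\<close> is the same at every level, so nothing accumulates in time.\<close>
    have bound: "\<forall>i j. (i, j) \<in> all_nodes Nx Ny \<longrightarrow> \<bar>e n i j\<bar> \<le> E * (w i * z j)" if "n \<le> Nt" for n
      using that
    proof (induction n rule: less_induct)
      case (less n)
      show ?case
      proof (cases n)
        case 0
        have "\<bar>e 0 i j\<bar> \<le> E * (w i * z j)" if "(i, j) \<in> all_nodes Nx Ny" for i j
        proof -
          have "end_weight (alpha P) * end_weight (beta P) \<le> w i * z j"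
            using w_bounds[of i] z_bounds[of j] end_weight_bounds[OF beta(1)] by (intro mult_mono) auto
          then have "E * (end_weight (alpha P) * end_weight (beta P)) \<le> E * (w i * z j)"
            using E by (rule mult_left_mono)
          moreover have "E * (end_weight (alpha P) * end_weight (beta P)) = grid_max_norm Nx Ny (e 0)"
            using ends by (auto simp: E_def K_def)
          ultimately show ?thesis using ge_norm[OF that] by linarith
        qed
        with 0 show ?thesis by blast
      next
        case (Suc k)
        have kNt: "k < Nt" using Suc less.prems by simp
        have "\<bar>e (k + 1) i j\<bar> \<le> E * (w i * z j)" if ij: "(i, j) \<in> all_nodes Nx Ny" for i j
        proof (rule weighted_max_principle[where S = S and Nx = Nx and Ny = Ny
              and r = "\<lambda>i j. memory_term (gam P) (\<lambda>n. e n i j) k"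
              and a = "\<lambda>i j. omega_x P Nx Ny Nt i j (k + 1)"
              and b = "\<lambda>i j. omega_y P Nx Ny Nt i j (k + 1)"
              and G = "g_coeff (alpha P) Nx" and H = "g_coeff (beta P) Ny"])
          fix i j assume "(i, j) \<in> all_nodes Nx Ny - S"
          then show "e (k + 1) i j = 0"
            using scheme_solution_bdry[OF u, of "k + 1" i j] scheme_solution_bdry[OF v, of "k + 1" i j] kNt
            by (simp add: S_def e_def)
        next
          fix i j assume ij: "(i, j) \<in> all_nodes Nx Ny \<inter> S"
          then have le: "i \<le> Nx" "j \<le> Ny" by (auto simp: all_nodes_def)
          have "scheme_eq P Nx Ny Nt u k i j" "scheme_eq P Nx Ny Nt v k i j"
            using scheme_solution_eq[OF u kNt] scheme_solution_eq[OF v kNt] ij by (simp_all add: S_def)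
          \<comment> \<open>The scheme is linear and the source term cancels in the
            difference.\<close>
          then show "e (k + 1) i j = memory_term (gam P) (\<lambda>n. e n i j) k
              + omega_x P Nx Ny Nt i j (k + 1) * (\<Sum>m\<le>Nx. g_coeff (alpha P) Nx i m * e (k + 1) m j)
              + omega_y P Nx Ny Nt i j (k + 1) * (\<Sum>m\<le>Ny. g_coeff (beta P) Ny j m * e (k + 1) i m)"
            unfolding scheme_eq_iff[OF le] scheme_rhs_memory e_def
            by (simp add: right_diff_distrib sum_subtractf flip: memory_term_diff)
          show "\<bar>memory_term (gam P) (\<lambda>n. e n i j) k\<bar> \<le> E * (w i * z j)"
            using less.IH Suc kNt ij by (intro memory_term_bound gam) auto
        next
          fix i j assume "(i, j) \<in> all_nodes Nx Ny"
          then have "i \<le> Nx" "j \<le> Ny" by (auto simp: all_nodes_def)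
          then show "0 \<le> omega_x P Nx Ny Nt i j (k + 1) \<and> 0 \<le> omega_y P Nx Ny Nt i j (k + 1)"
            using N kNt dom gam alpha beta
            by (intro conjI omega_x_nonneg omega_y_nonneg cx dy node_x_mem node_y_mem node_t_mem) auto
        qed (use alpha beta N E ij w_bounds z_bounds in
            \<open>auto simp: w_def z_def g_coeff_off_diag_nonneg sum_g_coeff_node_weight_nonpos\<close>)
        with Suc show ?thesis by simp
      qed
    qed
    \<comment> \<open>All weights are at most 1, so the return to the plain norm costs nothing here;
      the cost is already contained in \<open>K\<close>.\<close>
    have "\<bar>e k i j\<bar> \<le> E" if "(i, j) \<in> all_nodes Nx Ny" for i j
    proof -
      have "w i * z j \<le> 1"
        using w_bounds[of i] z_bounds[of j] by (intro mult_le_one) auto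
      then have "E * (w i * z j) \<le> E" using E by (simp add: mult_left_le)
      with bound[OF k] that show ?thesis by fastforce
    qed
    then have "grid_max_norm Nx Ny (e k) \<le> E"
      unfolding grid_max_norm_def using fin \<open>(0, 0) \<in> all_nodes Nx Ny\<close>
      by (subst Max_le_iff) auto
    then show ?thesis by (simp add: E_def e_def)
  qed
  then show ?thesis unfolding unconditionally_stable_def by blast
qed

theorem theorem3p5:
  fixes P :: cr_problem
  assumes "0 < gam P" and "gam P \<le> 1"
    and "1 < alpha P" and "alpha P \<le> 2"
    and "1 < beta P" and "beta P \<le> 2"
    and "xL P < xR P" and "yL P < yR P" and "0 < Tend P"
    and "\<And>x y t. x \<in> {xL P..xR P} \<Longrightarrow> y \<in> {yL P..yR P} \<Longrightarrow> t \<in> {0<..Tend P} \<Longrightarrow> 0 \<le> cx P x y t"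
    and "\<And>x y t. x \<in> {xL P..xR P} \<Longrightarrow> y \<in> {yL P..yR P} \<Longrightarrow> t \<in> {0<..Tend P} \<Longrightarrow> 0 \<le> dy P x y t"
  shows "unconditionally_stable P all_nodes \<and> unconditionally_stable P interior_nodes"
  using assms by (intro conjI unconditionally_stable_cr_scheme)

end
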